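(* Let $N\cong\mathbb{Z}^n$, let $P\subset N_{\mathbb{R}}$ be an $n$-dimensional Fano simplex, $F$ an admissible facet of $P$, $v_0$ a vertex of $F$, $\mathbf{w}_F\in M$ the primitive inward normal vector of $F$, and $Q=\mu_{F,v_0}(P)$ the mutation of $P$ over $F$ formed with the vertex $v_0$. Let $D(v_0)$ be the facet of $P^\vee$ dual to $v_0$. Then the sliding of $P^\vee$ along $(\mathbf{w}_F,D(v_0))$ coincides with $Q^\vee$: $$\mu_{\mathbf{w}_F,D(v_0)}(P^\vee)=Q^\vee .$$
   Context: Let $M=\mathrm{Hom}(N,\mathbb{Z})$, $N_{\mathbb{R}}=N\otimes\mathbb{R}$, $M_{\mathbb{R}}=M\otimes\mathbb{R}$. A Fano simplex is an $n$-dimensional lattice simplex $P\subset N_{\mathbb{R}}$ with the origin in its interior and all vertices primitive in $N$. The polar dual is $P^\vee=\{u\in M_{\mathbb{R}}:\langle u,v\rangle\ge-1\ \forall v\in P\}$, and $D(v_0)=\{u\in P^\vee:\langle u,v_0\rangle=-1\}$. For a facet $F$ of $P$ with primitive inward normal $\mathbf{w}_F\in M$, let $d_F\in\mathbb{Z}_{>0}$ be such that $\langle\mathbf{w}_F,\cdot\rangle=-d_F$ on $F$. $F$ is admissible if for a (equivalently, any) vertex $v_0$ of $F$, $G=\frac1{d_F}(F-v_0)$ is a lattice polytope. Then, with $h_{\max}=\max_{x\in P}\langle\mathbf{w}_F,x\rangle$ and $S_h=\mathrm{conv}(\{x\in P\cap N:\langle\mathbf{w}_F,x\rangle=h\})$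 (possibly empty), $$\mu_{F,v_0}(P)=\mathrm{conv}\Big(\{v_0\}\cup\bigcup_{h=0}^{h_{\max}}(S_h+hG)\Big),$$ which is again a Fano simplex. Sliding. Let $\Delta\subset M_{\mathbb{R}}$ be a convex polytope containing the origin in its interior, $\mathbf{w}\in M_{\mathbb{R}}$ a positive multiple of a vertex of $\Delta$, and $D$ a facet of $\Delta$ containing that vertex. Let $H_D$ be the hyperplane containing $D$ and $H_D^+$ the closed half-space bounded by $H_D$ containing $\Delta$. The sliding of $\Delta$ along $(\mathbf{w},D)$ is the convex polytope $\mu_{\mathbf{w},D}(\Delta)\subset H_D^+$ such that (i) for every line $\ell$ in direction $\mathbf{w}$, $|\ell\cap\Delta|=|\ell\cap\mu_{\mathbf{w},D}(\Delta)|$, where $|\cdot|$ denotes length; and (ii) $\ell\cap\mu_{\mathbf{w},D}(\Delta)\cap H_D$ consists of a single point whenever $\ell\cap\Delta\ne\emptyset$. (Here $\frac{1}{d_F}\mathbf{w}_F$ is the vertex of $P^\vee$ dual to $F$, and it lies in $D(v_0)$.) *)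

theory Defs
  imports "HOL-Analysis.Analysis"
begin

(* A basis of N is fixed, so N is the set of integer points of real^'n and n = CARD('n).
   M = Hom(N,Z) and its real form are identified with the integer points of real^'n and
   with real^'n itself through the dual basis; the pairing <u,v> becomes the inner product. *)

definition lattice_points :: "(real ^ 'n) set" where
  "lattice_points = {x. \<forall>i. x $ i \<in> \<int>}"

definition primitive_vector :: "real ^ 'n \<Rightarrow> bool" where
  "primitive_vector v \<longleftrightarrow> v \<in> lattice_points \<and> v \<noteq> 0 \<and>
     (\<forall>k::nat. \<forall>u\<in>lattice_points. v = real k *\<^sub>R u \<longrightarrow> k = 1)"

definition lattice_polytope :: "(real ^ 'n) set \<Rightarrow> bool" where
  "lattice_polytope X \<longleftrightarrow>
     (\<exists>V. finite V \<and> V \<subseteq> lattice_points \<and> X = convex hull V)"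

definition fano_simplex :: "(real ^ 'n) set \<Rightarrow> bool" where
  "fano_simplex P \<longleftrightarrow> int CARD('n) simplex P \<and> lattice_polytope P \<and>
     0 \<in> interior P \<and> (\<forall>v. v extreme_point_of P \<longrightarrow> primitive_vector v)"

definition polar_dual :: "(real ^ 'n) set \<Rightarrow> (real ^ 'n) set" where
  "polar_dual P = {u. \<forall>v\<in>P. u \<bullet> v \<ge> -1}"

definition dual_facet :: "(real ^ 'n) set \<Rightarrow> real ^ 'n \<Rightarrow> (real ^ 'n) set" where
  "dual_facet P v0 = {u \<in> polar_dual P. u \<bullet> v0 = -1}"

(* For a facet F of a Fano simplex P the pair (w, d) = (w_F, d_F) is uniquely determined. *)
definition primitive_inward_normal ::
  "(real ^ 'n) set \<Rightarrow> (real ^ 'n) set \<Rightarrow> real ^ 'n \<Rightarrow> int \<Rightarrow> bool" where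
  "primitive_inward_normal P F w d \<longleftrightarrow> primitive_vector w \<and> d > 0 \<and>
     (\<forall>x\<in>F. w \<bullet> x = - real_of_int d) \<and> (\<forall>x\<in>P. w \<bullet> x \<ge> - real_of_int d)"

definition mutation_factor ::
  "(real ^ 'n) set \<Rightarrow> int \<Rightarrow> real ^ 'n \<Rightarrow> (real ^ 'n) set" where
  "mutation_factor F d v0 = (\<lambda>x. (1 / real_of_int d) *\<^sub>R (x - v0)) ` F"

definition admissible_facet :: "(real ^ 'n) set \<Rightarrow> int \<Rightarrow> bool" where
  "admissible_facet F d \<longleftrightarrow>
     (\<exists>v. v extreme_point_of F \<and> lattice_polytope (mutation_factor F d v))"

definition height_slice ::
  "(real ^ 'n) set \<Rightarrow> real ^ 'n \<Rightarrow> nat \<Rightarrow> (real ^ 'n) set" where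
  "height_slice P w h = convex hull {x \<in> P \<inter> lattice_points. w \<bullet> x = real h}"

(* The Minkowski sum S_h + hG is empty when S_h is empty. *)
definition mutation ::
  "(real ^ 'n) set \<Rightarrow> (real ^ 'n) set \<Rightarrow> real ^ 'n \<Rightarrow> int \<Rightarrow> real ^ 'n \<Rightarrow> (real ^ 'n) set"
  where
  "mutation P F w d v0 = convex hull ({v0} \<union>
     (\<Union>h \<in> {h::nat. real h \<le> (SUP x\<in>P. w \<bullet> x)}.
        {s + real h *\<^sub>R g | s g. s \<in> height_slice P w h \<and> g \<in> mutation_factor F d v0}))"

definition line_through :: "real ^ 'n \<Rightarrow> real ^ 'n \<Rightarrow> (real ^ 'n) set" where
  "line_through p w = {p + t *\<^sub>R w | t. True}"

(* Length (one-dimensional Lebesgue measure) of X on the line through p in direction w;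
   norm w converts the parameter t into arc length. *)
definition length_on_line :: "real ^ 'n \<Rightarrow> real ^ 'n \<Rightarrow> (real ^ 'n) set \<Rightarrow> real" where
  "length_on_line p w X = norm w * measure lebesgue {t::real. p + t *\<^sub>R w \<in> X}"

definition sliding_data :: "(real ^ 'n) set \<Rightarrow> real ^ 'n \<Rightarrow> (real ^ 'n) set \<Rightarrow> bool" where
  "sliding_data \<Delta> w D \<longleftrightarrow> polytope \<Delta> \<and> 0 \<in> interior \<Delta> \<and> D facet_of \<Delta> \<and>
     (\<exists>x c. x extreme_point_of \<Delta> \<and> x \<in> D \<and> c > 0 \<and> w = c *\<^sub>R x)"

(* The hyperplane H_D containing the facet D is affine hull D. *)
definition is_sliding ::
  "(real ^ 'n) set \<Rightarrow> real ^ 'n \<Rightarrow> (real ^ 'n) set \<Rightarrow> (real ^ 'n) set \<Rightarrow> bool" where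
  "is_sliding \<Delta> w D S \<longleftrightarrow> sliding_data \<Delta> w D \<and> polytope S \<and>
     (\<exists>a b. a \<noteq> 0 \<and> affine hull D = {x. a \<bullet> x = b} \<and>
        \<Delta> \<subseteq> {x. a \<bullet> x \<le> b} \<and> S \<subseteq> {x. a \<bullet> x \<le> b}) \<and>
     (\<forall>p. length_on_line p w \<Delta> = length_on_line p w S) \<and>
     (\<forall>p. line_through p w \<inter> \<Delta> \<noteq> {} \<longrightarrow>
        (\<exists>y. line_through p w \<inter> S \<inter> affine hull D = {y}))"

definition sliding ::
  "(real ^ 'n) set \<Rightarrow> real ^ 'n \<Rightarrow> (real ^ 'n) set \<Rightarrow> (real ^ 'n) set" where
  "sliding \<Delta> w D = (THE S. is_sliding \<Delta> w D S)"

end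

theory Submission
  imports Defs
begin

text \<open>
Let \<open>K\<close> be the set of vertices of \<open>F\<close> and \<open>a\<close> the vertex of \<open>P\<close> opposite to \<open>F\<close>, at
height \<open>H = w \<bullet> a > 0\<close>, and put \<open>G = (F - v0)/d\<close>. As \<open>P\<close> is a pyramid over \<open>F\<close>, its slice at
height \<open>h\<close> is a convex combination of \<open>a\<close> and a homothetic copy of \<open>F\<close>; adding \<open>h G\<close>, which is
another such copy, changes the homothety ratio linearly in \<open>h\<close>, with value \<open>0\<close> at height \<open>-d\<close>.
Hence the mutation is the pyramid with apex \<open>v0\<close> over \<open>a + H G\<close> (\<open>mutation_eq\<close>): the facet
\<open>F\<close> is shrunk to a point and the vertex \<open>a\<close> is blown up to a facet.

On the dual side set \<open>gap u = max {u \<bullet> (v0 - v) / d | v \<in> K}\<close>. All vectors \<open>v0 - v\<close> are orthogonal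
to \<open>w\<close>, so \<open>gap\<close> is constant on every line in direction \<open>w\<close>. Evaluating the defining inequalities
at the vertices shows that \<open>u\<close> lies in the polar dual of the mutation exactly when
\<open>u - gap u *\<^sub>R w\<close> lies in the polar dual of \<open>P\<close> (\<open>polar_Q_shear\<close>). On each line in direction
\<open>w\<close> the two duals are thus translates of each other, which gives the condition on lengths. The
upper end of a segment in the dual of \<open>P\<close> is determined by the vertex \<open>v\<close> of \<open>F\<close> minimising
\<open>u \<bullet> v\<close>; translating by \<open>gap u\<close> moves it to the point where \<open>u \<bullet> v0 = -1\<close>, that is, onto the
hyperplane spanned by the facet dual to \<open>v0\<close> (\<open>polar_Q_reaches_hyperplane\<close>).

A sliding is unique (\<open>sliding_unique\<close>). Over a line that meets the original polytope it is the
segment of prescribed length ending on the hyperplane. Over a line that misses it, the condition on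
lengths alone would still permit a single point; convexity of the sliding excludes this
(\<open>sliding_shadow_subset\<close>).
\<close>

section \<open>Uniqueness of slidings\<close>

lemma line_meets_iff: "line_through p w \<inter> X \<noteq> {} \<longleftrightarrow> (\<exists>t. p + t *\<^sub>R w \<in> X)"
  by (auto simp: line_through_def)

lemma line_parameters_interval:
  fixes p w :: "real ^ 'n"
  assumes "polytope S" "w \<noteq> 0"
  obtains l r where "{t. p + t *\<^sub>R w \<in> S} = {l..r}"
proof -
  let ?f = "\<lambda>t::real. p + t *\<^sub>R w" and ?I = "{t. p + t *\<^sub>R w \<in> S}"
  have S: "convex S" "closed S" "bounded S"
    using assms polytope_imp_convex polytope_imp_closed polytope_imp_bounded by blast+
  have "convex ?I"
  proof (rule convexI)
    fix s t u v :: real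
    assume st: "s \<in> ?I" "t \<in> ?I" and uv: "0 \<le> u" "0 \<le> v" "u + v = 1"
    have eq: "?f (u *\<^sub>R s + v *\<^sub>R t) = u *\<^sub>R ?f s + v *\<^sub>R ?f t"
      using uv(3) by (simp add: algebra_simps flip: scaleR_add_left)
    show "u *\<^sub>R s + v *\<^sub>R t \<in> ?I"
      using convexD[OF S(1), of "?f s" "?f t"] st uv by (simp only: mem_Collect_eq eq)
  qed
  moreover have "closed ?I"
    using continuous_closed_vimage[OF S(2), of ?f] by (simp add: vimage_def)
  moreover have "bounded ?I"
  proof -
    from S(3) obtain B where B: "\<And>x. x \<in> S \<Longrightarrow> norm x \<le> B" by (auto simp: bounded_iff)
    have "norm t \<le> (B + norm p) / norm w" if "t \<in> ?I" for t
    proof -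
      have "norm (t *\<^sub>R w) \<le> norm (?f t) + norm p"
        using norm_triangle_ineq4[of "?f t" p] by simp
      also have "\<dots> \<le> B + norm p" using B that by simp
      finally show ?thesis using assms(2) by (simp add: field_simps)
    qed
    then show ?thesis by (auto simp: bounded_iff)
  qed
  ultimately have "connected ?I \<and> compact ?I"
    by (simp add: convex_connected compact_eq_bounded_closed)
  then show thesis using that by (auto simp: connected_compact_interval_1)
qed

text \<open>
The origin is strictly on one side of the hyperplane and \<open>w\<close> points from it to a point of the
hyperplane. So \<open>w\<close> leaves the half-space, and every line in direction \<open>w\<close> crosses the hyperplane
exactly once.
\<close>

lemma sliding_direction_transverse:
  assumes "sliding_data \<Delta> w D" "affine hull D = {x. a \<bullet> x = b}" "a \<noteq> 0"
    "\<Delta> \<subseteq> {x. a \<bullet> x \<le> b}"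
  shows "a \<bullet> w > 0"
proof -
  obtain x c where x: "x \<in> D" "c > 0" "w = c *\<^sub>R x" and int: "0 \<in> interior \<Delta>"
    using assms(1) by (auto simp: sliding_data_def)
  have "interior \<Delta> \<subseteq> interior {x. a \<bullet> x \<le> b}" using assms(4) by (rule interior_mono)
  then have "b > 0" using int assms(3) by auto
  moreover have "a \<bullet> x = b" using x(1) assms(2) hull_inc[of x D affine] by blast
  ultimately show ?thesis using x by simp
qed

text \<open>
The right-hand side does not mention \<open>S\<close>: the trace of \<open>S\<close> on the line is a segment whose length
is prescribed and whose endpoint in direction \<open>w\<close> is the crossing point with the hyperplane, because
\<open>S\<close> contains that point and stays on one side of it.
\<close>

lemma sliding_on_line:
  assumes S: "is_sliding \<Delta> w D S" and meets: "line_through p w \<inter> \<Delta> \<noteq> {}"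
    and T: "p + T *\<^sub>R w \<in> affine hull D"
  shows "p + t *\<^sub>R w \<in> S \<longleftrightarrow> T - length_on_line p w \<Delta> / norm w \<le> t \<and> t \<le> T"
proof -
  obtain a b where ab: "a \<noteq> 0" "affine hull D = {x. a \<bullet> x = b}"
      "\<Delta> \<subseteq> {x. a \<bullet> x \<le> b}" "S \<subseteq> {x. a \<bullet> x \<le> b}"
    using S by (auto simp: is_sliding_def)
  have "sliding_data \<Delta> w D" using S by (auto simp: is_sliding_def)
  then have aw: "a \<bullet> w > 0" using ab sliding_direction_transverse by blast
  then have w: "w \<noteq> 0" by auto
  have polyS: "polytope S" using S by (auto simp: is_sliding_def)
  obtain l r where lr: "{t. p + t *\<^sub>R w \<in> S} = {l..r}"
    using line_parameters_interval[OF polyS w] by blast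
  have Tb: "a \<bullet> p + T * (a \<bullet> w) = b" using T ab(2) by (simp add: inner_add_right)
  obtain y where y: "y \<in> line_through p w" "y \<in> S" "y \<in> affine hull D"
    using S meets unfolding is_sliding_def by blast
  then obtain t' where t': "y = p + t' *\<^sub>R w" by (auto simp: line_through_def)
  have "t' = T" using y(3) t' ab(2) Tb aw by (auto simp: inner_add_right)
  then have "T \<in> {l..r}" using y t' lr by blast
  moreover have "t \<le> T" if "t \<in> {l..r}" for t
  proof -
    have "p + t *\<^sub>R w \<in> S" using that lr by blast
    then have "a \<bullet> p + t * (a \<bullet> w) \<le> b" using ab(4) by (auto simp: inner_add_right)
    then show ?thesis using Tb aw by (smt (verit) mult_le_cancel_right)
  qed
  ultimately have r: "r = T" "l \<le> r" by (auto intro: antisym)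
  have "length_on_line p w \<Delta> = norm w * (r - l)"
    using S lr r(2) by (auto simp: is_sliding_def length_on_line_def)
  then have "l = T - length_on_line p w \<Delta> / norm w" using w r by (simp add: field_simps)
  then show ?thesis using lr r by auto
qed

text \<open>
If the line through \<open>q\<close> missed \<open>\<Delta>\<close>, then \<open>S\<close> would still contain the convex hull of \<open>q\<close> and of
its segment of positive length on the line through the origin. The line through \<open>(1 - s) *\<^sub>R q\<close>
therefore meets \<open>S\<close>, and hence \<open>\<Delta>\<close>, in positive length for every \<open>0 < s \<le> 1\<close>. The union of the
lines that meet \<open>\<Delta>\<close> is closed, so letting \<open>s\<close> tend to \<open>0\<close> gives a contradiction.
\<close>

lemma sliding_shadow_subset:
  assumes S: "is_sliding \<Delta> w D S" and q: "q \<in> S"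
  shows "line_through q w \<inter> \<Delta> \<noteq> {}"
proof -
  obtain a b where ab: "a \<noteq> 0" "affine hull D = {x. a \<bullet> x = b}" "\<Delta> \<subseteq> {x. a \<bullet> x \<le> b}"
    using S by (auto simp: is_sliding_def)
  have data: "sliding_data \<Delta> w D" using S by (auto simp: is_sliding_def)
  have aw: "a \<bullet> w > 0" using data ab sliding_direction_transverse by blast
  then have w: "w \<noteq> 0" by auto
  have poly: "polytope \<Delta>" "polytope S" and int: "0 \<in> interior \<Delta>"
    and len: "\<And>p. length_on_line p w \<Delta> = length_on_line p w S"
    using S by (auto simp: is_sliding_def sliding_data_def)
  have convS: "convex S" using poly(2) polytope_imp_convex by blast
  obtain l r where lr: "{t. 0 + t *\<^sub>R w \<in> \<Delta>} = {l..r}"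
    using line_parameters_interval[OF poly(1) w] by blast
  obtain e where e: "e > 0" "cball 0 e \<subseteq> \<Delta>"
    using int by (auto simp: mem_interior_cball)
  have "e / norm w \<in> {t. 0 + t *\<^sub>R w \<in> \<Delta>}" "0 \<in> {t. 0 + t *\<^sub>R w \<in> \<Delta>}"
    using e w by auto
  then have "l \<le> 0" "e / norm w \<le> r" unfolding lr by auto
  moreover have "e / norm w > 0" using e w by simp
  ultimately have lr0: "l < r" by linarith
  obtain l' r' where lr': "{t. 0 + t *\<^sub>R w \<in> S} = {l'..r'}"
    using line_parameters_interval[OF poly(2) w] by blast
  have "measure lebesgue {l..r} = measure lebesgue {l'..r'}"
    using len[of 0] lr lr' w by (simp add: length_on_line_def)
  then have lr0': "l' < r'" using lr0 by (cases "l' \<le> r'") auto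
  have near: "\<exists>t. (1 - s) *\<^sub>R q + t *\<^sub>R w \<in> \<Delta>" if s: "0 < s" "s \<le> 1" for s
  proof (rule ccontr)
    assume "\<not> ?thesis"
    then have "length_on_line ((1 - s) *\<^sub>R q) w \<Delta> = 0" by (simp add: length_on_line_def)
    then have 0: "measure lebesgue {t. (1 - s) *\<^sub>R q + t *\<^sub>R w \<in> S} = 0"
      using len[of "(1 - s) *\<^sub>R q"] w by (simp add: length_on_line_def)
    obtain l2 r2 where lr2: "{t. (1 - s) *\<^sub>R q + t *\<^sub>R w \<in> S} = {l2..r2}"
      using line_parameters_interval[OF poly(2) w] by blast
    have in2: "s * t \<in> {l2..r2}" if "t \<in> {l'..r'}" for t
    proof -
      have "t *\<^sub>R w \<in> S" using that lr' by auto
      then have "(1 - s) *\<^sub>R q + s *\<^sub>R (t *\<^sub>R w) \<in> S"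
        using convexD[OF convS q, of "t *\<^sub>R w" "1 - s" s] s by simp
      then show ?thesis using lr2 by auto
    qed
    have "s * l' \<in> {l2..r2}" "s * r' \<in> {l2..r2}" using in2 lr0' by auto
    moreover have "s * l' < s * r'" using s lr0' by simp
    ultimately have "l2 < r2" by auto
    then show False using 0 lr2 by simp
  qed
  \<comment> \<open>The union of all lines in direction \<open>w\<close> that meet \<open>\<Delta>\<close>.\<close>
  let ?C = "\<Union>x\<in>\<Delta>. \<Union>y\<in>span {w}. {x + y}"
  have "closed ?C"
    by (intro compact_closed_sums closed_span polytope_imp_compact poly)
  have mem: "x \<in> ?C \<longleftrightarrow> (\<exists>t. x + t *\<^sub>R w \<in> \<Delta>)" for x
  proof
    assume "x \<in> ?C"
    then obtain z t where "z \<in> \<Delta>" "x = z + t *\<^sub>R w" by (auto simp: span_singleton)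
    then have "x + (- t) *\<^sub>R w \<in> \<Delta>" by simp
    then show "\<exists>t. x + t *\<^sub>R w \<in> \<Delta>" by blast
  next
    assume "\<exists>t. x + t *\<^sub>R w \<in> \<Delta>"
    then obtain t where "x + t *\<^sub>R w \<in> \<Delta>" by blast
    moreover have "x = (x + t *\<^sub>R w) + (- t) *\<^sub>R w" "(- t) *\<^sub>R w \<in> span {w}"
      by (auto intro: span_base span_scale span_neg)
    ultimately show "x \<in> ?C" by blast
  qed
  have "(\<lambda>n. (1 - 1 / real (Suc n)) *\<^sub>R q) \<longlonglongrightarrow> (1 - 0) *\<^sub>R q"
    using LIMSEQ_inverse_real_of_nat by (intro tendsto_intros) (simp add: inverse_eq_divide)
  moreover have "\<forall>n. (1 - 1 / real (Suc n)) *\<^sub>R q \<in> ?C"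
    unfolding mem using near by simp
  ultimately have "q \<in> ?C"
    using \<open>closed ?C\<close> closed_sequentially[of ?C "\<lambda>n. (1 - 1 / real (Suc n)) *\<^sub>R q" q] by simp
  then show ?thesis unfolding mem line_meets_iff .
qed

lemma sliding_subset:
  assumes S: "is_sliding \<Delta> w D S" and S': "is_sliding \<Delta> w D S'"
  shows "S \<subseteq> S'"
proof
  fix q assume q: "q \<in> S"
  have meets: "line_through q w \<inter> \<Delta> \<noteq> {}" using sliding_shadow_subset[OF S q] .
  then obtain y where "y \<in> line_through q w" "y \<in> affine hull D"
    using S unfolding is_sliding_def by blast
  then obtain T where T: "q + T *\<^sub>R w \<in> affine hull D" by (auto simp: line_through_def)
  have "q + 0 *\<^sub>R w \<in> S" using q by simp
  then have "q + 0 *\<^sub>R w \<in> S'"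
    unfolding sliding_on_line[OF S meets T] sliding_on_line[OF S' meets T] .
  then show "q \<in> S'" by simp
qed

lemma sliding_unique: "is_sliding \<Delta> w D S \<Longrightarrow> is_sliding \<Delta> w D S' \<Longrightarrow> S = S'"
  by (simp add: antisym sliding_subset)

section \<open>Polar duals of polytopes\<close>

lemma polar_dual_convex_hull: "polar_dual (convex hull V) = polar_dual V"
proof
  show "polar_dual (convex hull V) \<subseteq> polar_dual V"
    by (auto simp: polar_dual_def hull_inc)
  show "polar_dual V \<subseteq> polar_dual (convex hull V)"
  proof
    fix u assume "u \<in> polar_dual V"
    then have "V \<subseteq> {v. u \<bullet> v \<ge> -1}" by (auto simp: polar_dual_def)
    then have "convex hull V \<subseteq> {v. u \<bullet> v \<ge> -1}"
      by (intro hull_minimal convex_halfspace_ge)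
    then show "u \<in> polar_dual (convex hull V)" by (auto simp: polar_dual_def)
  qed
qed

lemma polyhedron_polar_dual: "finite V \<Longrightarrow> polyhedron (polar_dual V)"
proof -
  assume V: "finite V"
  have "polar_dual V = \<Inter>((\<lambda>v. {u. v \<bullet> u \<ge> -1}) ` V)"
    by (auto simp: polar_dual_def inner_commute)
  then show ?thesis using V by (auto intro: polyhedron_Inter polyhedron_halfspace_ge)
qed

lemma bounded_polar_dual:
  assumes "0 \<in> interior P"
  shows "bounded (polar_dual P)"
proof -
  obtain e where e: "e > 0" "cball 0 e \<subseteq> P" using assms by (auto simp: mem_interior_cball)
  have "norm u \<le> 1 / e" if u: "u \<in> polar_dual P" for u
  proof (cases "u = 0")
    case False
    have "- (e / norm u) *\<^sub>R u \<in> P" using e False by (intro subsetD[OF e(2)]) simp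
    then have "u \<bullet> (- (e / norm u) *\<^sub>R u) \<ge> -1" using u unfolding polar_dual_def by blast
    then have "e * norm u \<le> 1"
      using False by (simp add: power2_norm_eq_inner[symmetric] power2_eq_square)
    then show ?thesis using e by (simp add: field_simps)
  qed (use e in simp)
  then show ?thesis by (auto simp: bounded_iff)
qed

lemma interior_polar_dual:
  fixes P :: "(real ^ 'n) set"
  assumes "bounded P"
  shows "0 \<in> interior (polar_dual P)"
proof -
  obtain B where B: "B > 0" "\<And>x. x \<in> P \<Longrightarrow> norm x \<le> B" using assms by (auto simp: bounded_pos)
  have "cball 0 (1 / B) \<subseteq> polar_dual P"
  proof
    fix u :: "real ^ 'n" assume u: "u \<in> cball 0 (1 / B)"
    show "u \<in> polar_dual P" unfolding polar_dual_def
    proof (intro CollectI ballI)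
      fix x assume x: "x \<in> P"
      have "\<bar>u \<bullet> x\<bar> \<le> norm u * norm x" by (rule Cauchy_Schwarz_ineq2)
      also have "\<dots> \<le> (1 / B) * B" using u x B by (intro mult_mono) auto
      finally show "u \<bullet> x \<ge> -1" using B by simp
    qed
  qed
  moreover have "1 / B > 0" using B(1) by simp
  ultimately show ?thesis unfolding mem_interior_cball by blast
qed

lemma polytope_polar_dual:
  assumes "polytope P" "0 \<in> interior P"
  shows "polytope (polar_dual P)"
proof -
  obtain V where "finite V" "P = convex hull V" using assms(1) by (auto simp: polytope_def)
  then show ?thesis
    using assms(2) bounded_polar_dual polyhedron_polar_dual polar_dual_convex_hull
    by (metis polytope_eq_bounded_polyhedron)
qed

lemma dual_facet_Int: "dual_facet P v = polar_dual P \<inter> {u. v \<bullet> u = -1}"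
  by (auto simp: dual_facet_def inner_commute)

text \<open>
A vertex of a polytope is exposed, and a supporting hyperplane that touches \<open>P\<close> only in \<open>v0\<close>
becomes, after scaling, a point \<open>u0\<close> at which the constraint of \<open>v0\<close> is tight and the constraints
of all other vertices are strict. Near \<open>u0\<close> the dual face is therefore the whole hyperplane.
\<close>

lemma affine_hull_dual_facet:
  assumes P: "polytope P" "0 \<in> interior P" and v0: "v0 extreme_point_of P"
  shows "affine hull (dual_facet P v0) = {u. v0 \<bullet> u = -1}"
proof -
  obtain V where V: "finite V" "P = convex hull V" using P(1) by (auto simp: polytope_def)
  have "{v0} exposed_face_of P"
    using P(1) v0 by (simp add: exposed_face_of_polyhedron polytope_imp_polyhedron face_of_singleton)
  then obtain a b where ab: "P \<subseteq> {x. a \<bullet> x \<le> b}" "{v0} = P \<inter> {x. a \<bullet> x = b}"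
    by (auto simp: exposed_face_of_def)
  have V0: "V \<subseteq> P" "v0 \<in> V"
    using V v0 extreme_point_of_convex_hull by (auto simp: hull_inc)
  have "b > 0"
  proof (cases "a = 0")
    case True
    then have "b = 0" using ab(2) by (auto split: if_splits)
    then have "P = {v0}" using ab(2) True by auto
    then show ?thesis using P(2) by simp
  next
    case False
    have "0 \<in> interior {x. a \<bullet> x \<le> b}" using interior_mono[OF ab(1)] P(2) by blast
    then show ?thesis using False by simp
  qed
  define u0 where "u0 = (- (1 / b)) *\<^sub>R a"
  let ?T = "\<Inter>v\<in>V - {v0}. {u. v \<bullet> u \<ge> -1}"
  have "u0 \<in> (\<Inter>v\<in>V - {v0}. {u. v \<bullet> u > -1})"
  proof
    fix v assume v: "v \<in> V - {v0}"
    then have "a \<bullet> v \<noteq> b" "a \<bullet> v \<le> b" using ab V0 by blast+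
    then have "a \<bullet> v < b" by simp
    then show "u0 \<in> {u. v \<bullet> u > -1}" using \<open>b > 0\<close>
      by (simp add: u0_def inner_commute field_simps)
  qed
  moreover have "open (\<Inter>v\<in>V - {v0}. {u. v \<bullet> u > -1})"
    using V(1) by (auto intro!: open_INT open_halfspace_gt)
  moreover have "(\<Inter>v\<in>V - {v0}. {u. v \<bullet> u > -1}) \<subseteq> ?T" by force
  ultimately have "u0 \<in> interior ?T" by (meson interiorI)
  moreover have "v0 \<bullet> u0 = -1"
    using ab(2) \<open>b > 0\<close> by (auto simp: u0_def inner_commute)
  ultimately have ne: "{u. v0 \<bullet> u = -1} \<inter> interior ?T \<noteq> {}" by blast
  have "dual_facet P v0 = {u. v0 \<bullet> u = -1} \<inter> ?T"
    using V0(2) unfolding dual_facet_Int V(2) polar_dual_convex_hull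
    by (auto simp: polar_dual_def inner_commute)
  then show ?thesis
    using affine_hull_affine_Int_nonempty_interior[OF affine_hyperplane ne]
    by (simp add: hull_same affine_hyperplane)
qed

lemma dual_facet_is_facet:
  fixes P :: "(real ^ 'n) set"
  assumes P: "polytope P" "0 \<in> interior P" and v0: "v0 extreme_point_of P" "v0 \<noteq> 0"
  shows "dual_facet P v0 facet_of polar_dual P"
proof -
  note hull = affine_hull_dual_facet[OF P v0(1)]
  have v0P: "v0 \<in> P" using v0 by (simp add: extreme_point_of_def)
  have "dual_facet P v0 face_of polar_dual P"
    unfolding dual_facet_Int
    using v0P polytope_polar_dual[OF P] polytope_imp_convex
    by (intro face_of_Int_supporting_hyperplane_ge)
      (auto simp: polar_dual_def inner_commute)
  moreover have dim: "aff_dim (dual_facet P v0) = int CARD('n) - 1"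
    using aff_dim_hyperplane[OF v0(2), of "-1"] hull aff_dim_affine_hull[of "dual_facet P v0"]
    by simp
  moreover have "dual_facet P v0 \<noteq> {}"
  proof
    assume "dual_facet P v0 = {}"
    then have "{u. v0 \<bullet> u = -1} = {}" using hull by simp
    moreover have "v0 \<bullet> ((- 1 / (v0 \<bullet> v0)) *\<^sub>R v0) = -1" using v0(2) by simp
    ultimately show False by blast
  qed
  moreover have "aff_dim (polar_dual P) = int CARD('n)"
    using interior_polar_dual[of P] P(1) polytope_imp_bounded aff_dim_nonempty_interior[of "polar_dual P"]
    by auto
  ultimately show ?thesis by (simp add: facet_of_def)
qed

text \<open>
Otherwise \<open>u - u'\<close> would vanish on \<open>F\<close> and at the origin, which does not lie in the affine hull
of \<open>F\<close>, and hence on the whole space.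
\<close>

lemma dual_point_of_full_facet_unique:
  fixes F :: "(real ^ 'n) set"
  assumes dim: "aff_dim F = int CARD('n) - 1"
    and u: "\<And>x. x \<in> F \<Longrightarrow> u \<bullet> x = -1" and u': "\<And>x. x \<in> F \<Longrightarrow> u' \<bullet> x = -1"
  shows "u = u'"
proof (rule ccontr)
  assume ne: "u \<noteq> u'"
  have "affine hull F \<subseteq> {x. u \<bullet> x = -1}"
    using u by (intro hull_minimal affine_hyperplane) auto
  then have "0 \<notin> affine hull F" by auto
  then have "aff_dim (insert 0 F) = int CARD('n)" using dim by (simp add: aff_dim_insert)
  moreover have "insert 0 F \<subseteq> {x. (u - u') \<bullet> x = 0}"
    using u u' by (auto simp: inner_diff_left)
  then have "aff_dim (insert 0 F) \<le> aff_dim {x. (u - u') \<bullet> x = 0}" by (rule aff_dim_subset)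
  then have "aff_dim (insert 0 F) \<le> int CARD('n) - 1" using ne by simp
  ultimately show False by simp
qed

lemma dual_vertex_extreme:
  fixes P F :: "(real ^ 'n) set"
  assumes dim: "aff_dim F = int CARD('n) - 1" and sub: "F \<subseteq> P"
    and x: "x \<in> polar_dual P" "\<And>y. y \<in> F \<Longrightarrow> x \<bullet> y = -1"
  shows "x extreme_point_of polar_dual P"
  unfolding extreme_point_of_def
proof (intro conjI ballI x notI)
  fix a b assume a: "a \<in> polar_dual P" and b: "b \<in> polar_dual P" and seg: "x \<in> open_segment a b"
  obtain s where s: "a \<noteq> b" "0 < s" "s < 1" "x = (1 - s) *\<^sub>R a + s *\<^sub>R b"
    using seg by (auto simp: in_segment)
  have "a \<bullet> y = -1 \<and> b \<bullet> y = -1" if "y \<in> F" for y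
  proof -
    have ge: "a \<bullet> y \<ge> -1" "b \<bullet> y \<ge> -1"
      using a b that sub by (auto simp: polar_dual_def)
    have "(1 - s) * (a \<bullet> y + 1) + s * (b \<bullet> y + 1) = 0"
      using x(2)[OF that] s(4) by (simp add: inner_add_left algebra_simps)
    moreover have "(1 - s) * (a \<bullet> y + 1) \<ge> 0" "s * (b \<bullet> y + 1) \<ge> 0"
      using ge s by simp_all
    ultimately have "(1 - s) * (a \<bullet> y + 1) = 0" "s * (b \<bullet> y + 1) = 0" by linarith+
    then show ?thesis using s by simp
  qed
  then have "a = b" by (intro dual_point_of_full_facet_unique[OF dim]) auto
  then show False using s(1) by simp
qed

section \<open>Mutation and its polar dual for a pyramid\<close>

locale pyramid =
  fixes K :: "(real ^ 'n) set" and v0 a w :: "real ^ 'n" and d :: int and H :: real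
  assumes finite_base: "finite K" and base_vertex: "v0 \<in> K"
    and depth_pos: "d > 0" and height_pos: "H > 0"
    and base_height: "\<And>v. v \<in> K \<Longrightarrow> w \<bullet> v = - real_of_int d"
    and apex_height: "w \<bullet> a = H"
begin

abbreviation "P \<equiv> convex hull (insert a K)"

abbreviation "F \<equiv> convex hull K"

text \<open>
The map \<open>x \<mapsto> a + H (x - v0)/d\<close>, which carries \<open>F\<close> onto the top slice \<open>a + H G\<close> of the mutation.
\<close>

abbreviation "tilt \<equiv> (\<lambda>v. a + (H / real_of_int d) *\<^sub>R (v - v0))"

abbreviation "Q \<equiv> convex hull (insert v0 (tilt ` K))"

lemma base_height_hull: "x \<in> F \<Longrightarrow> w \<bullet> x = - real_of_int d"
proof -
  have "F \<subseteq> {x. w \<bullet> x = - real_of_int d}"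
    using base_height by (intro hull_minimal) (auto simp: convex_hyperplane)
  then show "x \<in> F \<Longrightarrow> w \<bullet> x = - real_of_int d" by auto
qed

lemma max_height: "(SUP x\<in>P. w \<bullet> x) = H"
proof (rule cSup_eq_maximum)
  show "H \<in> (\<bullet>) w ` P" using apex_height by (auto intro!: image_eqI[of _ _ a] hull_inc)
  have "P \<subseteq> {x. w \<bullet> x \<le> H}"
    using base_height apex_height height_pos depth_pos
    by (intro hull_minimal convex_halfspace_le) auto
  then show "y \<le> H" if "y \<in> (\<bullet>) w ` P" for y using that by auto
qed

lemma tilt_hull: "x \<in> F \<Longrightarrow> tilt x \<in> Q"
proof -
  assume x: "x \<in> F"
  let ?c = "H / real_of_int d"
  have eq: "tilt = (\<lambda>v. (a - ?c *\<^sub>R v0) + ?c *\<^sub>R v)" by (auto simp: algebra_simps)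
  have "tilt x \<in> convex hull (tilt ` K)"
    unfolding eq convex_hull_affinity
    using x by (auto simp: algebra_simps intro!: image_eqI[of _ _ x])
  then show ?thesis using hull_mono[of "tilt ` K" "insert v0 (tilt ` K)" convex] by blast
qed

text \<open>
A point of \<open>P\<close> at height \<open>h\<close> is \<open>t a + r f\<close> with \<open>t H = r d + h\<close>. This relation makes the
coefficients \<open>r\<close> of \<open>f\<close> and \<open>h / d\<close> of \<open>g\<close> add up to \<open>t H / d\<close>, the ratio of the slice of \<open>Q\<close> at
the same height.
\<close>

lemma shifted_slice_subset:
  assumes s: "s \<in> P" "w \<bullet> s = h" and h: "0 \<le> h" and g: "g \<in> F"
  shows "s + h *\<^sub>R ((1 / real_of_int d) *\<^sub>R (g - v0)) \<in> Q"
proof -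
  let ?d = "real_of_int d"
  have d: "?d > 0" using depth_pos by simp
  obtain t r f where tr: "0 \<le> t" "0 \<le> r" "t + r = 1" "f \<in> F" "s = t *\<^sub>R a + r *\<^sub>R f"
    using s(1) base_vertex by (subst (asm) convex_hull_insert) auto
  have ht: "t * H - r * ?d = h"
    using s(2) tr(4,5) base_height_hull apex_height by (simp add: inner_add_right)
  have "t > 0"
  proof (rule ccontr)
    assume "\<not> t > 0"
    then have "t = 0" "r = 1" using tr by auto
    then show False using ht h d by simp
  qed
  define m where "m = t * H"
  have m: "m > 0" "m = r * ?d + h" using \<open>t > 0\<close> height_pos ht by (auto simp: m_def)
  \<comment> \<open>The point of \<open>F\<close> at which the homothetic copies of \<open>F\<close> coming from \<open>f\<close> and from \<open>g\<close> add up.\<close>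
  define x where "x = (r * ?d / m) *\<^sub>R f + (h / m) *\<^sub>R g"
  have "x \<in> F" unfolding x_def
    using tr(2,4) g h d m
    by (intro convexD[OF convex_convex_hull]) (auto simp: add_divide_distrib[symmetric])
  then have "tilt x \<in> Q" by (rule tilt_hull)
  moreover have "v0 \<in> Q" by (simp add: hull_inc)
  ultimately have in_Q: "r *\<^sub>R v0 + t *\<^sub>R tilt x \<in> Q"
    using tr by (intro convexD[OF convex_convex_hull]) auto
  have mx: "(m / ?d) *\<^sub>R x = r *\<^sub>R f + (h / ?d) *\<^sub>R g"
    using m(1) d by (simp add: x_def scaleR_add_right)
  have md: "m / ?d = r + h / ?d" using m(2) d by (simp add: field_simps)
  have "r *\<^sub>R v0 + t *\<^sub>R tilt x = t *\<^sub>R a + r *\<^sub>R v0 + ((m / ?d) *\<^sub>R x - (m / ?d) *\<^sub>R v0)"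
    by (simp add: m_def scaleR_add_right scaleR_diff_right)
  also have "\<dots> = s + h *\<^sub>R ((1 / ?d) *\<^sub>R (g - v0))"
    unfolding mx unfolding md tr(5)
    by (simp add: scaleR_add_left scaleR_diff_right)
  finally have "r *\<^sub>R v0 + t *\<^sub>R tilt x = s + h *\<^sub>R ((1 / ?d) *\<^sub>R (g - v0))" .
  then show ?thesis using in_Q by simp
qed

text \<open>
The lower slices contribute nothing beyond the hull of \<open>v0\<close> and the top slice. Integrality is what
makes the top height one of the heights in the mutation, with \<open>a\<close> as a point of its slice.
\<close>

lemma mutation_eq:
  assumes a: "a \<in> lattice_points" and k: "H = real k"
  shows "mutation P F w d v0 = Q"
proof -
  let ?X = "\<Union>h \<in> {h::nat. real h \<le> (SUP x\<in>P. w \<bullet> x)}.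
        {s + real h *\<^sub>R g | s g. s \<in> height_slice P w h \<and> g \<in> mutation_factor F d v0}"
  have slice: "height_slice P w h \<subseteq> P \<inter> {x. w \<bullet> x = real h}" for h
    unfolding height_slice_def
    by (intro hull_minimal convex_Int convex_convex_hull convex_hyperplane) auto
  have "?X \<subseteq> Q"
    using slice shifted_slice_subset by (fastforce simp: mutation_factor_def)
  moreover have "v0 \<in> Q" by (simp add: hull_inc)
  ultimately have "mutation P F w d v0 \<subseteq> Q"
    unfolding mutation_def by (intro hull_minimal convex_convex_hull) auto
  moreover have "Q \<subseteq> mutation P F w d v0"
    unfolding mutation_def
  proof (rule hull_mono, rule subsetI)
    fix x assume "x \<in> insert v0 (tilt ` K)"
    then consider "x = v0" | v where "v \<in> K" "x = tilt v" by auto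
    then show "x \<in> {v0} \<union> ?X"
    proof cases
      case (2 v)
      let ?g = "(1 / real_of_int d) *\<^sub>R (v - v0)"
      have "a \<in> height_slice P w k"
        using a apex_height k by (auto simp: height_slice_def intro!: hull_inc)
      moreover have "?g \<in> mutation_factor F d v0"
        using 2 by (auto simp: mutation_factor_def hull_inc)
      moreover have "x = a + real k *\<^sub>R ?g" using 2 k by simp
      moreover have "k \<in> {h::nat. real h \<le> (SUP x\<in>P. w \<bullet> x)}" using k max_height by simp
      ultimately show ?thesis by blast
    qed auto
  qed
  ultimately show ?thesis by blast
qed

text \<open>
The distance, in units of \<open>w\<close>, by which sliding moves the segment of the polar dual of \<open>P\<close> on the
line through \<open>u\<close>: it is the difference between the parameter at which the line crosses the hyperplane
of \<open>v0\<close> and the smallest parameter at which it crosses the hyperplane of a vertex in \<open>K\<close>.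
\<close>

definition gap :: "real ^ 'n \<Rightarrow> real" where
  "gap u = Max ((\<lambda>v. u \<bullet> (v0 - v) / real_of_int d) ` K)"

lemma gap_ge: "v \<in> K \<Longrightarrow> u \<bullet> (v0 - v) / real_of_int d \<le> gap u"
  unfolding gap_def using finite_base by (intro Max_ge) auto

lemma gap_attained:
  obtains v where "v \<in> K" "gap u = u \<bullet> (v0 - v) / real_of_int d"
proof -
  have "gap u \<in> (\<lambda>v. u \<bullet> (v0 - v) / real_of_int d) ` K"
    unfolding gap_def using finite_base base_vertex by (intro Max_in) auto
  then show thesis using that by auto
qed

lemma gap_nonneg: "gap u \<ge> 0"
  using gap_ge[OF base_vertex, of u] by simp

lemma gap_translate: "gap (u + t *\<^sub>R w) = gap u"
  unfolding gap_def using base_height base_vertex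
  by (intro arg_cong[where f = Max] image_cong) (auto simp: inner_add_left inner_diff_right)

lemma polar_P_iff: "u \<in> polar_dual P \<longleftrightarrow> u \<bullet> a \<ge> -1 \<and> (\<forall>v\<in>K. u \<bullet> v \<ge> -1)"
  unfolding polar_dual_convex_hull by (auto simp: polar_dual_def)

lemma polar_base_iff: "(\<forall>v\<in>K. u \<bullet> v \<ge> -1) \<longleftrightarrow> u \<bullet> v0 - real_of_int d * gap u \<ge> -1"
proof
  assume *: "\<forall>v\<in>K. u \<bullet> v \<ge> -1"
  obtain v where "v \<in> K" "gap u = u \<bullet> (v0 - v) / real_of_int d" by (rule gap_attained)
  then show "u \<bullet> v0 - real_of_int d * gap u \<ge> -1"
    using * depth_pos by (simp add: inner_diff_right)
next
  assume *: "u \<bullet> v0 - real_of_int d * gap u \<ge> -1"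
  show "\<forall>v\<in>K. u \<bullet> v \<ge> -1"
  proof
    fix v assume "v \<in> K"
    then have "u \<bullet> v0 - u \<bullet> v \<le> real_of_int d * gap u"
      using gap_ge[of v u] depth_pos by (simp add: inner_diff_right field_simps)
    then show "u \<bullet> v \<ge> -1" using * by linarith
  qed
qed

lemma polar_Q_iff: "u \<in> polar_dual Q \<longleftrightarrow> u \<bullet> a - H * gap u \<ge> -1 \<and> u \<bullet> v0 \<ge> -1"
proof -
  have tilt: "u \<bullet> tilt v = u \<bullet> a - H * (u \<bullet> (v0 - v) / real_of_int d)" for v
    by (simp add: inner_add_right inner_diff_right right_diff_distrib diff_divide_distrib)
  have "(\<forall>v\<in>K. u \<bullet> tilt v \<ge> -1) \<longleftrightarrow> u \<bullet> a - H * gap u \<ge> -1"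
  proof
    assume *: "\<forall>v\<in>K. u \<bullet> tilt v \<ge> -1"
    obtain v where "v \<in> K" "gap u = u \<bullet> (v0 - v) / real_of_int d" by (rule gap_attained)
    then show "u \<bullet> a - H * gap u \<ge> -1" using * tilt by metis
  next
    assume *: "u \<bullet> a - H * gap u \<ge> -1"
    show "\<forall>v\<in>K. u \<bullet> tilt v \<ge> -1"
    proof
      fix v assume "v \<in> K"
      then have "H * (u \<bullet> (v0 - v) / real_of_int d) \<le> H * gap u"
        using gap_ge height_pos by (intro mult_left_mono) auto
      then show "u \<bullet> tilt v \<ge> -1" using * tilt by simp
    qed
  qed
  then show ?thesis unfolding polar_dual_convex_hull by (auto simp: polar_dual_def)
qed

text \<open>
Subtracting \<open>gap u *\<^sub>R w\<close> raises the values on \<open>K\<close> by \<open>d * gap u\<close>, so that their minimum becomes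
\<open>u \<bullet> v0\<close>, and lowers the value at \<open>a\<close> by \<open>H * gap u\<close>. These are the two inequalities that
define the dual of \<open>Q\<close>.
\<close>

lemma polar_Q_shear: "u \<in> polar_dual Q \<longleftrightarrow> u - gap u *\<^sub>R w \<in> polar_dual P"
proof -
  have "gap (u - gap u *\<^sub>R w) = gap u" using gap_translate[of u "- gap u"] by simp
  then show ?thesis
    unfolding polar_Q_iff polar_P_iff polar_base_iff
    using apex_height base_height[OF base_vertex]
    by (simp add: inner_diff_left algebra_simps)
qed

text \<open>
Boundedness is inherited from the dual of \<open>P\<close>: since \<open>d * gap u\<close> is at most \<open>1 + u \<bullet> v0\<close> there,
the shear displaces points by a bounded amount.
\<close>

lemma polytope_polar_Q:
  assumes "0 \<in> interior P"
  shows "polytope (polar_dual Q)"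
proof -
  let ?d = "real_of_int d"
  have d: "?d > 0" using depth_pos by simp
  obtain B where B: "\<And>u. u \<in> polar_dual P \<Longrightarrow> norm u \<le> B"
    using bounded_polar_dual[OF assms] by (auto simp: bounded_iff)
  have "norm u \<le> B + (1 + B * norm v0) / ?d * norm w" if u: "u \<in> polar_dual Q" for u
  proof -
    define u' where "u' = u - gap u *\<^sub>R w"
    have u': "u' \<in> polar_dual P" using u by (simp add: u'_def polar_Q_shear)
    have "gap u' = gap u" using gap_translate[of u "- gap u"] by (simp add: u'_def)
    then have "?d * gap u \<le> 1 + u' \<bullet> v0"
      using u' by (simp add: polar_P_iff polar_base_iff)
    also have "u' \<bullet> v0 \<le> norm u' * norm v0" by (rule norm_cauchy_schwarz)
    also have "\<dots> \<le> B * norm v0" using B[OF u'] by (intro mult_right_mono) auto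
    finally have "gap u \<le> (1 + B * norm v0) / ?d" using d by (simp add: field_simps)
    then have "gap u * norm w \<le> (1 + B * norm v0) / ?d * norm w"
      by (intro mult_right_mono) auto
    moreover have "norm u \<le> norm u' + gap u * norm w"
      using norm_triangle_ineq[of u' "gap u *\<^sub>R w"] gap_nonneg[of u] by (simp add: u'_def)
    ultimately show ?thesis using B[OF u'] by linarith
  qed
  then have "bounded (polar_dual Q)" by (auto simp: bounded_iff)
  moreover have "polyhedron (polar_dual Q)"
    unfolding polar_dual_convex_hull using finite_base by (intro polyhedron_polar_dual) simp
  ultimately show ?thesis by (simp add: polytope_eq_bounded_polyhedron)
qed

lemma length_polar_Q: "length_on_line p w (polar_dual P) = length_on_line p w (polar_dual Q)"
proof -
  have "t \<in> {t. p + t *\<^sub>R w \<in> polar_dual Q} \<longleftrightarrow> t - gap p \<in> {t. p + t *\<^sub>R w \<in> polar_dual P}" for t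
    by (simp add: polar_Q_shear gap_translate scaleR_diff_left add_diff_eq)
  then have "{t. p + t *\<^sub>R w \<in> polar_dual Q} = (+) (gap p) ` {t. p + t *\<^sub>R w \<in> polar_dual P}"
    by (force intro!: image_eqI[where x = "_ - gap p"])
  then show ?thesis by (simp add: length_on_line_def measure_translation)
qed

text \<open>
The upper end of the segment of the dual of \<open>P\<close> is cut out by the constraints from \<open>K\<close>,
and its parameter is smaller than the crossing parameter with the hyperplane of \<open>v0\<close> by exactly
\<open>gap p\<close>. The constraint from \<open>a\<close> persists because \<open>w \<bullet> a > 0\<close>.
\<close>

lemma polar_Q_reaches_hyperplane:
  assumes "p + t *\<^sub>R w \<in> polar_dual P"
  shows "p + ((1 + p \<bullet> v0) / real_of_int d) *\<^sub>R w \<in> polar_dual Q"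
proof -
  let ?d = "real_of_int d" and ?T = "(1 + p \<bullet> v0) / real_of_int d"
  have d: "?d > 0" using depth_pos by simp
  have wv0: "w \<bullet> v0 = - ?d" using base_height base_vertex by blast
  have P: "p \<bullet> a + t * H \<ge> -1" "p \<bullet> v0 - t * ?d - ?d * gap p \<ge> -1"
    using assms wv0 apex_height unfolding polar_P_iff polar_base_iff
    by (auto simp: gap_translate inner_add_left)
  have "?d * ?T = 1 + p \<bullet> v0" using d by simp
  then have "?d * t \<le> ?d * (?T - gap p)"
    using P(2) by (simp only: right_diff_distrib) (simp add: mult.commute)
  then have "t \<le> ?T - gap p" using d by simp
  then have "t * H \<le> (?T - gap p) * H" using height_pos by (intro mult_right_mono) auto
  then have "p \<bullet> a + ?T * H - H * gap p \<ge> -1" using P(1) by (simp add: algebra_simps)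
  moreover have "p \<bullet> v0 + ?T * - ?d = -1" using d by simp
  ultimately show ?thesis
    by (simp add: polar_Q_iff gap_translate inner_add_left wv0 apex_height)
qed

lemma is_sliding_polar_Q:
  assumes int: "0 \<in> interior P" and dim: "aff_dim F = int CARD('n) - 1"
    and v0: "v0 extreme_point_of P"
  shows "is_sliding (polar_dual P) w (dual_facet P v0) (polar_dual Q)"
proof -
  let ?d = "real_of_int d"
  have d: "?d > 0" using depth_pos by simp
  have wv0: "w \<bullet> v0 = - ?d" using base_height base_vertex by blast
  then have "v0 \<noteq> 0" using d by auto
  have poly: "polytope P" using finite_base by (auto simp: polytope_def)
  note hull = affine_hull_dual_facet[OF poly int v0]
  let ?x = "(1 / ?d) *\<^sub>R w"
  have x: "?x \<in> polar_dual P"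
    using base_height apex_height divide_pos_pos[OF height_pos d] d by (simp add: polar_P_iff)
  have "?x extreme_point_of polar_dual P"
    using d x base_height_hull by (intro dual_vertex_extreme[OF dim]) (auto intro: hull_mono[THEN subsetD])
  moreover have "?x \<in> dual_facet P v0" using x wv0 d by (simp add: dual_facet_def)
  moreover have "w = ?d *\<^sub>R ?x" using d by simp
  ultimately have data: "sliding_data (polar_dual P) w (dual_facet P v0)"
    unfolding sliding_data_def
    using polytope_polar_dual[OF poly int] interior_polar_dual[OF polytope_imp_bounded[OF poly]]
      dual_facet_is_facet[OF poly int v0 \<open>v0 \<noteq> 0\<close>] d by blast
  have side: "\<exists>a' b. a' \<noteq> 0 \<and> affine hull dual_facet P v0 = {x. a' \<bullet> x = b} \<and>
      polar_dual P \<subseteq> {x. a' \<bullet> x \<le> b} \<and> polar_dual Q \<subseteq> {x. a' \<bullet> x \<le> b}"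
  proof (intro exI[of _ "- v0"] exI[of _ 1] conjI)
    show "affine hull dual_facet P v0 = {x. - v0 \<bullet> x = 1}" unfolding hull by force
    show "polar_dual P \<subseteq> {x. - v0 \<bullet> x \<le> 1}"
      using base_vertex by (auto simp: polar_P_iff inner_commute)
    show "polar_dual Q \<subseteq> {x. - v0 \<bullet> x \<le> 1}" by (auto simp: polar_Q_iff inner_commute)
  qed (use \<open>v0 \<noteq> 0\<close> in simp)
  have pt: "\<exists>y. line_through p w \<inter> polar_dual Q \<inter> affine hull dual_facet P v0 = {y}"
    if meets: "line_through p w \<inter> polar_dual P \<noteq> {}" for p
  proof -
    define T where "T = (1 + p \<bullet> v0) / ?d"
    have on: "p + t *\<^sub>R w \<in> affine hull dual_facet P v0 \<longleftrightarrow> t = T" for t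
      unfolding hull using wv0 d by (auto simp: T_def inner_add_right inner_commute field_simps)
    have "p + T *\<^sub>R w \<in> polar_dual Q"
      using meets polar_Q_reaches_hyperplane unfolding line_meets_iff T_def by blast
    then have "line_through p w \<inter> polar_dual Q \<inter> affine hull dual_facet P v0 = {p + T *\<^sub>R w}"
      using on by (auto simp: line_through_def)
    then show ?thesis by blast
  qed
  show ?thesis
    unfolding is_sliding_def using data polytope_polar_Q[OF int] side length_polar_Q pt by blast
qed

end

theorem proposition5p5:
  fixes P F Q :: "(real ^ 'n) set" and v0 w :: "real ^ 'n" and d :: int
  assumes "fano_simplex P"
    and "F facet_of P"
    and "primitive_inward_normal P F w d"
    and "admissible_facet F d"
    and "v0 extreme_point_of F"
    and "Q = mutation P F w d v0"
  shows "(\<exists>!S. is_sliding (polar_dual P) w (dual_facet P v0) S) \<and>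
         sliding (polar_dual P) w (dual_facet P v0) = polar_dual Q"
proof -
  obtain C where C: "\<not> affine_dependent C" "P = convex hull C"
    using assms(1) by (auto simp: fano_simplex_def simplex_def)
  have int: "0 \<in> interior P" using assms(1) by (simp add: fano_simplex_def)
  have "finite C" using C(1) by (rule aff_independent_finite)
  obtain a where a: "a \<in> C" "F = convex hull (C - {a})"
    using assms(2) C by (auto simp: facet_of_convex_hull_affine_independent)
  define K where "K = C - {a}"
  have PK: "P = convex hull (insert a K)" and FK: "F = convex hull K" and "finite K"
    using C a \<open>finite C\<close> by (auto simp: K_def insert_absorb)
  have w: "w \<in> lattice_points" "w \<noteq> 0" "d > 0"
      "\<And>x. x \<in> F \<Longrightarrow> w \<bullet> x = - real_of_int d"
    using assms(3) by (auto simp: primitive_inward_normal_def primitive_vector_def)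
  have "a extreme_point_of P"
    using a(1) C extreme_point_of_convex_hull_affine_independent by blast
  then have a_lat: "a \<in> lattice_points"
    using assms(1) by (auto simp: fano_simplex_def primitive_vector_def)
  have "w \<bullet> a \<in> \<int>"
    using a_lat w(1) unfolding inner_vec_def by (auto simp: lattice_points_def intro!: Ints_sum)
  moreover have pos: "w \<bullet> a > 0"
  proof (rule ccontr)
    assume "\<not> w \<bullet> a > 0"
    then have "P \<subseteq> {x. w \<bullet> x \<le> 0}"
      unfolding PK using w(3,4) FK
      by (intro hull_minimal convex_halfspace_le) (auto simp: hull_inc)
    then have "0 \<in> interior {x. w \<bullet> x \<le> 0}" using int interior_mono by blast
    then show False using w(2) by simp
  qed
  ultimately obtain k :: nat where k: "w \<bullet> a = real k"
    by (metis Ints_cases of_int_0_less_iff of_int_of_nat_eq zero_less_imp_eq_int)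
  interpret pyramid K v0 a w d "w \<bullet> a"
    using \<open>finite K\<close> assms(5) w pos FK
    by unfold_locales (auto simp: hull_inc dest: extreme_point_of_convex_hull)
  have v0: "v0 extreme_point_of P"
    using assms(2,5) by (meson extreme_point_of_face facet_of_imp_face_of)
  have "aff_dim P = int CARD('n)" using aff_dim_nonempty_interior[of P] int by auto
  then have "aff_dim F = int CARD('n) - 1" using assms(2) by (simp add: facet_of_def)
  then have sl: "is_sliding (polar_dual P) w (dual_facet P v0) (polar_dual Q)"
    using is_sliding_polar_Q mutation_eq[OF a_lat k] int v0 assms(6) PK FK by simp
  then have ex1: "\<exists>!S. is_sliding (polar_dual P) w (dual_facet P v0) S"
    using sliding_unique by blast
  moreover have "sliding (polar_dual P) w (dual_facet P v0) = polar_dual Q"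
    unfolding sliding_def using sl ex1 by (rule the1_equality[rotated])
  ultimately show ?thesis by blast
qed

end
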